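(* Let $a,b,n$ be positive integers with $1\le a<b$, and let $G$ be a finite simple graph with minimum degree $\delta(G)\geq a+n$ and isolated toughness $I(G)\geq a-1+n+\frac{a-1}{b}$. Then for every $n$-element subset $V'\subset V(G)$, the graph $G-V'$ has an $[a,b]$-factor.
   Context: For a graph $G$ and $S\subseteq V(G)$, $i(G-S)$ denotes the number of isolated vertices of $G-S$. The isolated toughness of $G$ is $I(G)=\min\{|S|/i(G-S): S\subseteq V(G),\ i(G-S)\geq 2\}$ if $G$ is not complete, and $I(G)=|V(G)|-1$ if $G$ is complete. A spanning subgraph $H$ of $G$ is an $[a,b]$-factor if $a\le d_H(x)\le b$ for every $x\in V(G)$. *)

theory Defs
  imports Complex_Main
begin

type_synonym 'a ugraph = "'a set \<times> 'a set set"

abbreviation verts :: "'a ugraph \<Rightarrow> 'a set" where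
  "verts G \<equiv> fst G"

abbreviation edges :: "'a ugraph \<Rightarrow> 'a set set" where
  "edges G \<equiv> snd G"

definition finite_simple_graph :: "'a ugraph \<Rightarrow> bool" where
  "finite_simple_graph G \<longleftrightarrow>
     finite (verts G) \<and> (\<forall>e\<in>edges G. e \<subseteq> verts G \<and> card e = 2)"

definition degree :: "'a ugraph \<Rightarrow> 'a \<Rightarrow> nat" where
  "degree G x = card {e \<in> edges G. x \<in> e}"

(* Unspecified when the vertex set is empty. *)
definition min_degree :: "'a ugraph \<Rightarrow> nat" where
  "min_degree G = Min (degree G ` verts G)"

definition complete_graph :: "'a ugraph \<Rightarrow> bool" where
  "complete_graph G \<longleftrightarrow> (\<forall>x\<in>verts G. \<forall>y\<in>verts G. x \<noteq> y \<longrightarrow> {x, y} \<in> edges G)"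

definition delete_verts :: "'a ugraph \<Rightarrow> 'a set \<Rightarrow> 'a ugraph" where
  "delete_verts G S = (verts G - S, {e \<in> edges G. e \<inter> S = {}})"

definition num_isolated :: "'a ugraph \<Rightarrow> nat" where
  "num_isolated G = card {x \<in> verts G. degree G x = 0}"

(* In the second case the set is finite and nonempty for a finite simple graph:
   if x, y are distinct and nonadjacent, deleting all other vertices
   leaves two isolated vertices. *)
definition isolated_toughness :: "'a ugraph \<Rightarrow> real" where
  "isolated_toughness G =
     (if complete_graph G then real (card (verts G)) - 1
      else Min {real (card S) / real (num_isolated (delete_verts G S)) | S.
                  S \<subseteq> verts G \<and> num_isolated (delete_verts G S) \<ge> 2})"

definition spanning_subgraph :: "'a ugraph \<Rightarrow> 'a ugraph \<Rightarrow> bool" where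
  "spanning_subgraph H G \<longleftrightarrow> verts H = verts G \<and> edges H \<subseteq> edges G"

definition is_factor :: "nat \<Rightarrow> nat \<Rightarrow> 'a ugraph \<Rightarrow> 'a ugraph \<Rightarrow> bool" where
  "is_factor a b H G \<longleftrightarrow>
     spanning_subgraph H G \<and> (\<forall>x\<in>verts G. a \<le> degree H x \<and> degree H x \<le> b)"

end

theory Submission
  imports Defs
begin

text \<open>If a < b, a graph without an [a,b]-factor has a set S for which the vertices of G - S of degree
  below a have total deficiency exceeding b |S|: among the subgraphs with degrees at most b take one
  of least total deficiency, and let S be the vertices reachable from a deficient vertex by alternating
  walks of odd length. Apply this to G - V', and choose greedily, by increasing degree, an independent
  set I of deficient vertices of K = G - V' - S, so that b |S| is less than the sum of
  (a - d x) (d x + 1) over I, where d is the degree in K. Deleting V', S and the neighbours of I in K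
  isolates I, which contradicts the toughness bound if |I| is at least 2; if |I| = 1, the minimum
  degree gives the contradiction.\<close>

section \<open>Degrees, neighbourhoods and vertex deletion\<close>

lemma degree_pair: "degree (V, F) x = card {e \<in> F. x \<in> e}"
  by (simp add: degree_def)

lemma finite_edges: "finite_simple_graph G \<Longrightarrow> finite (edges G)"
  unfolding finite_simple_graph_def by (meson Pow_iff finite_Pow_iff rev_finite_subset subsetI)

lemma edge_ends_distinct: "finite_simple_graph G \<Longrightarrow> {x, y} \<in> edges G \<Longrightarrow> x \<noteq> y"
  unfolding finite_simple_graph_def by fastforce

lemma edge_ends_in_verts:
  "finite_simple_graph G \<Longrightarrow> {x, y} \<in> edges G \<Longrightarrow> x \<in> verts G \<and> y \<in> verts G"
  unfolding finite_simple_graph_def by fastforce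

lemma edge_other_end:
  assumes "finite_simple_graph G" "e \<in> edges G" "x \<in> e"
  obtains y where "e = {x, y}"
proof -
  have "card e = 2" using assms by (auto simp: finite_simple_graph_def)
  then show thesis using assms(3) that by (auto simp: card_2_iff)
qed

lemma finite_nbrs: "finite_simple_graph G \<Longrightarrow> finite {y. {x, y} \<in> edges G}"
  by (rule finite_subset[of _ "verts G"]) (auto dest: edge_ends_in_verts simp: finite_simple_graph_def)

lemma degree_eq_card_nbrs:
  assumes "finite_simple_graph G"
  shows "degree G x = card {y. {x, y} \<in> edges G}"
proof -
  have "bij_betw (\<lambda>y. {x, y}) {y. {x, y} \<in> edges G} {e \<in> edges G. x \<in> e}"
    by (rule bij_betwI') (auto simp: doubleton_eq_iff elim: edge_other_end[OF assms])
  then show ?thesis unfolding degree_def by (simp add: bij_betw_same_card)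
qed

lemma finite_simple_graph_delete_verts:
  "finite_simple_graph G \<Longrightarrow> finite_simple_graph (delete_verts G S)"
  unfolding finite_simple_graph_def delete_verts_def by auto

lemma delete_verts_delete_verts:
  "delete_verts (delete_verts G S) T = delete_verts G (S \<union> T)"
  unfolding delete_verts_def by auto

lemma degree_le_degree_delete_verts:
  assumes G: "finite_simple_graph G" and W: "finite W" "x \<notin> W"
  shows "degree G x \<le> degree (delete_verts G W) x + card W"
proof -
  let ?N = "{y. {x, y} \<in> edges (delete_verts G W)}"
  have "{y. {x, y} \<in> edges G} \<subseteq> ?N \<union> W"
    using W by (auto simp: delete_verts_def)
  then have "card {y. {x, y} \<in> edges G} \<le> card (?N \<union> W)"
    using W finite_nbrs[OF finite_simple_graph_delete_verts[OF G]] by (intro card_mono) auto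
  also have "\<dots> \<le> card ?N + card W" by (rule card_Un_le)
  finally show ?thesis
    using G by (simp add: degree_eq_card_nbrs finite_simple_graph_delete_verts)
qed

lemma min_degree_le:
  "finite_simple_graph G \<Longrightarrow> x \<in> verts G \<Longrightarrow> min_degree G \<le> degree G x"
  unfolding min_degree_def finite_simple_graph_def by (intro Min_le) auto

section \<open>A criterion for the existence of an [a,b]-factor\<close>

lemma degree_insert_edge:
  assumes "finite F" "{x, y} \<notin> F" "x \<noteq> y"
  shows "degree (V, insert {x, y} F) z = degree (V, F) z + of_bool (z = x) + of_bool (z = y)"
proof (cases "z \<in> {x, y}")
  case True
  then have "{e \<in> insert {x, y} F. z \<in> e} = insert {x, y} {e \<in> F. z \<in> e}" by auto
  then show ?thesis using assms True by (auto simp: degree_pair)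
next
  case False
  then have "{e \<in> insert {x, y} F. z \<in> e} = {e \<in> F. z \<in> e}" by auto
  then show ?thesis using False by (simp add: degree_pair)
qed

lemma degree_remove_edge:
  assumes "finite F" "{x, y} \<in> F" "x \<noteq> y"
  shows "degree (V, F) z = degree (V, F - {{x, y}}) z + of_bool (z = x) + of_bool (z = y)"
  using degree_insert_edge[of "F - {{x, y}}" x y V z] assms by (simp add: insert_absorb)

text \<open>The first edge lies outside \<open>H\<close>, and vertices and edges may repeat. Only
  the values of \<open>p\<close> up to \<open>k\<close> matter.\<close>

definition alternating_walk :: "'a set set \<Rightarrow> 'a set set \<Rightarrow> 'a \<Rightarrow> (nat \<Rightarrow> 'a) \<Rightarrow> nat \<Rightarrow> bool" where
  "alternating_walk E H u p k \<longleftrightarrow>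
     p 0 = u \<and> (\<forall>i<k. {p i, p (Suc i)} \<in> (if even i then E - H else H))"

text \<open>For an alternating walk with distinct edges this is the symmetric difference of
  \<open>H\<close> with the first \<open>j\<close> edges. Building it edge by edge lets the degrees
  be followed by induction.\<close>

fun flip_walk :: "'a set set \<Rightarrow> (nat \<Rightarrow> 'a) \<Rightarrow> nat \<Rightarrow> 'a set set" where
  "flip_walk H p 0 = H"
| "flip_walk H p (Suc j) =
     (if even j then insert {p j, p (Suc j)} (flip_walk H p j)
      else flip_walk H p j - {{p j, p (Suc j)}})"

lemma alternating_walk_edge:
  "alternating_walk E H u p k \<Longrightarrow> i < k \<Longrightarrow> {p i, p (Suc i)} \<in> H \<longleftrightarrow> odd i"
  unfolding alternating_walk_def by (metis DiffD2)

lemma alternating_walk_edge_in: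
  assumes "alternating_walk E H u p k" "H \<subseteq> E" "i < k"
  shows "{p i, p (Suc i)} \<in> E"
proof -
  have "{p i, p (Suc i)} \<in> (if even i then E - H else H)"
    using assms by (simp add: alternating_walk_def)
  then show ?thesis using assms(2) by (cases "even i") auto
qed

lemma alternating_walk_prefix:
  "alternating_walk E H u p k \<Longrightarrow> i \<le> k \<Longrightarrow> alternating_walk E H u p i"
  unfolding alternating_walk_def by auto

lemma alternating_walk_snoc:
  assumes "alternating_walk E H u p k" "{p k, y} \<in> (if even k then E - H else H)"
  shows "alternating_walk E H u (p(Suc k := y)) (Suc k)"
  using assms unfolding alternating_walk_def by (auto simp: less_Suc_eq)

text \<open>Cutting out a closed stretch of even length leaves the parity of all later positions
  unchanged, so the walk still alternates at the joint.\<close>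

lemma alternating_walk_shortcut:
  assumes w: "alternating_walk E H u p k" and ij: "i < j" "j \<le> k" "even (j - i)" "p i = p j"
  shows "alternating_walk E H u (\<lambda>m. if m \<le> i then p m else p (m + (j - i))) (k - (j - i))"
  unfolding alternating_walk_def
proof (intro conjI allI impI)
  show "(if 0 \<le> i then p 0 else p (0 + (j - i))) = u"
    using w by (simp add: alternating_walk_def)
next
  fix m assume m: "m < k - (j - i)"
  have *: "{p l, p (Suc l)} \<in> (if even l then E - H else H)" if "l < k" for l
    using w that by (simp add: alternating_walk_def)
  consider "Suc m \<le> i" | "m = i" | "m > i" by linarith
  then show "{if m \<le> i then p m else p (m + (j - i)),
              if Suc m \<le> i then p (Suc m) else p (Suc m + (j - i))}
             \<in> (if even m then E - H else H)"
  proof cases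
    case 1 then show ?thesis using *[of m] m by simp
  next
    \<comment> \<open>The edge at the joint is the old edge at position \<open>j\<close>, whose
      parity is that of \<open>i\<close>.\<close>
    case 2
    have "even j \<longleftrightarrow> even i" using ij by simp
    then show ?thesis using 2 *[of j] m ij by simp
  next
    case 3
    have "even (m + (j - i)) \<longleftrightarrow> even m" using ij(3) by (metis even_add)
    then show ?thesis using 3 *[of "m + (j - i)"] m by simp
  qed
qed

lemma finite_flip_walk: "finite H \<Longrightarrow> finite (flip_walk H p j)"
  by (induction j) auto

lemma flip_walk_subset:
  assumes "alternating_walk E H u p k" "H \<subseteq> E"
  shows "j \<le> k \<Longrightarrow> flip_walk H p j \<subseteq> E"
proof (induction j)
  case (Suc j)
  have "{p j, p (Suc j)} \<in> E"
    using alternating_walk_edge_in[OF assms] Suc.prems by simp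
  then show ?case using Suc by auto
qed (use assms in auto)

text \<open>At an inner position one edge is added and one removed, so only the start and the
  current end change degree. For \<open>j = 0\<close> the two correction terms cancel. The first
  conjunct carries the induction: edges not yet reached are untouched, because all edges of the walk
  are distinct.\<close>

lemma degree_flip_walk:
  assumes "finite H" and w: "alternating_walk E H u p k"
    and ends: "\<And>i. i < k \<Longrightarrow> p i \<noteq> p (Suc i)"
    and dist: "\<And>i j. i < j \<Longrightarrow> j < k \<Longrightarrow> {p i, p (Suc i)} \<noteq> {p j, p (Suc j)}"
  shows "j \<le> k \<Longrightarrow>
    (\<forall>i. j \<le> i \<longrightarrow> i < k \<longrightarrow> ({p i, p (Suc i)} \<in> flip_walk H p j \<longleftrightarrow> odd i)) \<and>
    (\<forall>x. int (degree (V, flip_walk H p j) x) =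
         int (degree (V, H) x) + of_bool (x = u) + (if odd j then 1 else -1) * of_bool (x = p j))"
proof (induction j)
  case 0
  have "p 0 = u" using w by (simp add: alternating_walk_def)
  then show ?case using alternating_walk_edge[OF w] by simp
next
  case (Suc j)
  then have j: "j < k"
    and deg: "\<And>x. int (degree (V, flip_walk H p j) x) =
      int (degree (V, H) x) + of_bool (x = u) + (if odd j then 1 else -1) * of_bool (x = p j)"
    and mem: "\<And>i. j \<le> i \<Longrightarrow> i < k \<Longrightarrow> {p i, p (Suc i)} \<in> flip_walk H p j \<longleftrightarrow> odd i"
    by auto
  have fin: "finite (flip_walk H p j)" using assms(1) by (rule finite_flip_walk)
  have "{p i, p (Suc i)} \<in> flip_walk H p (Suc j) \<longleftrightarrow> odd i" if "Suc j \<le> i" "i < k" for i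
    using mem[of i] dist[of j i] that by auto
  moreover have "int (degree (V, flip_walk H p (Suc j)) x) = int (degree (V, H) x) + of_bool (x = u)
      + (if odd (Suc j) then 1 else -1) * of_bool (x = p (Suc j))" for x
  proof (cases "even j")
    case True
    then show ?thesis
      using degree_insert_edge[OF fin, of "p j" "p (Suc j)" V x] mem[of j] ends[of j] j deg[of x]
      by simp
  next
    case False
    then show ?thesis
      using degree_remove_edge[OF fin, of "p j" "p (Suc j)" V x] mem[of j] ends[of j] j deg[of x]
      by simp
  qed
  ultimately show ?case by blast
qed

text \<open>After flipping, the end gains an edge if \<open>k\<close> is odd and, if
  \<open>k\<close> is even and positive, loses one. The condition leaves room for that change within
  the bounds \<open>a\<close> and \<open>b\<close>.\<close>

definition augmenting :: "nat \<Rightarrow> nat \<Rightarrow> 'a ugraph \<Rightarrow> (nat \<Rightarrow> 'a) \<Rightarrow> nat \<Rightarrow> bool" where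
  "augmenting a b H p k \<longleftrightarrow> (if odd k then degree H (p k) < b else a < degree H (p k))"

text \<open>Before its end, a shortest augmenting walk has degrees at most a in even and at least b in odd
  positions; since a < b, no vertex occurs in positions of both parities, except possibly the last.\<close>

lemma augmenting_improves:
  assumes G: "finite_simple_graph (V, E)" and "H \<subseteq> E" and "a < b"
    and u: "u \<in> V" "degree (V, H) u < a"
    and Hb: "\<forall>x\<in>V. degree (V, H) x \<le> b"
    and ex: "\<exists>p. alternating_walk E H u p k \<and> augmenting a b (V, H) p k"
  shows "\<exists>H'\<subseteq>E. (\<forall>x\<in>V. degree (V, H') x \<le> b) \<and>
    (\<Sum>x\<in>V. a - degree (V, H') x) < (\<Sum>x\<in>V. a - degree (V, H) x)"
proof -
  define k where "k = (LEAST k. \<exists>p. alternating_walk E H u p k \<and> augmenting a b (V, H) p k)"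
  have "\<exists>p. alternating_walk E H u p k \<and> augmenting a b (V, H) p k"
    unfolding k_def by (rule LeastI, rule ex)
  then obtain p where w: "alternating_walk E H u p k" and aug: "augmenting a b (V, H) p k"
    by blast
  have min: "\<not> augmenting a b (V, H) q i" if "alternating_walk E H u q i" "i < k" for q i
    using that not_less_Least unfolding k_def by blast
  have finH: "finite H" using finite_edges[OF G] \<open>H \<subseteq> E\<close> finite_subset by auto
  have even_pos: "degree (V, H) (p i) \<le> a" if "i < k" "even i" for i
    using min[OF alternating_walk_prefix[OF w] that(1)] that by (auto simp: augmenting_def)
  have odd_pos: "b \<le> degree (V, H) (p i)" if "i < k" "odd i" for i
    using min[OF alternating_walk_prefix[OF w] that(1)] that by (auto simp: augmenting_def)
  have same_parity: "p i \<noteq> p j" if "i < j" "j \<le> k" "even (j - i)" for i j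
  proof
    assume eq: "p i = p j"
    let ?q = "\<lambda>m. if m \<le> i then p m else p (m + (j - i))"
    \<comment> \<open>If \<open>j = k\<close>, the shortened walk stops at \<open>p i\<close>, which
      is the same vertex as \<open>p k\<close>.\<close>
    have "?q (k - (j - i)) = p k" using that eq by (cases "j = k") auto
    moreover have "even (k - (j - i)) \<longleftrightarrow> even k" using that by auto
    ultimately have "augmenting a b (V, H) ?q (k - (j - i))"
      using aug unfolding augmenting_def by (simp only:)
    moreover have "k - (j - i) < k" using that by simp
    ultimately show False using min alternating_walk_shortcut[OF w that eq] by blast
  qed
  have inj: "p i \<noteq> p j" if "i < j" "j < k" for i j
  proof (cases "even (j - i)")
    case True then show ?thesis using same_parity that by auto
  next
    case False
    then have "even i \<longleftrightarrow> odd j" using that by auto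
    then show ?thesis
      using even_pos[of i] odd_pos[of i] even_pos[of j] odd_pos[of j] that \<open>a < b\<close>
      by (cases "even i") fastforce+
  qed
  have edge: "{p i, p (Suc i)} \<in> E" if "i < k" for i
    using alternating_walk_edge_in[OF w \<open>H \<subseteq> E\<close> that] .
  have ends: "p i \<noteq> p (Suc i)" if "i < k" for i
    using edge_ends_distinct[OF G] edge[OF that] by auto
  \<comment> \<open>Membership in \<open>H\<close> fixes the parity of the position, so equal edges
    are at least two positions apart. Then \<open>p j\<close> differs from both ends of the earlier
    edge; \<open>p (Suc j)\<close> is avoided since it may be the last vertex.\<close>
  have dist: "{p i, p (Suc i)} \<noteq> {p j, p (Suc j)}" if "i < j" "j < k" for i j
  proof
    assume eq: "{p i, p (Suc i)} = {p j, p (Suc j)}"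
    then have "odd i \<longleftrightarrow> odd j"
      using alternating_walk_edge[OF w, of i] alternating_walk_edge[OF w, of j] that by auto
    then have "Suc i < j" using that by (metis Suc_lessI even_Suc)
    then have "p i \<noteq> p j" "p (Suc i) \<noteq> p j" using inj that by auto
    then show False using eq ends[of i] that by (auto simp: doubleton_eq_iff)
  qed
  have deg: "int (degree (V, flip_walk H p k) x) = int (degree (V, H) x) + of_bool (x = u)
      + (if odd k then 1 else -1) * of_bool (x = p k)" for x
    using degree_flip_walk[OF finH w ends dist, of k V] by auto
  \<comment> \<open>Only an end at even \<open>k\<close> can lose an edge, and its degree exceeds
    \<open>a\<close> beforehand. Hence no deficiency grows.\<close>
  have ge: "min a (degree (V, H) x) \<le> degree (V, flip_walk H p k) x" for x
    using deg[of x] aug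
    by (cases "x = u"; cases "x = p k") (auto simp: augmenting_def split: if_splits)
  \<comment> \<open>If the walk ends at \<open>u\<close>, then \<open>k\<close> is odd, since the
    degree of \<open>u\<close> is below \<open>a\<close>. In that case \<open>u\<close> gains two,
    which \<open>a < b\<close> permits.\<close>
  have "degree (V, flip_walk H p k) x \<le> b" if "x \<in> V" for x
    using deg[of x] aug Hb that u \<open>a < b\<close>
    by (cases "x = u"; cases "x = p k") (force simp: augmenting_def split: if_splits)+
  moreover have "flip_walk H p k \<subseteq> E"
    using flip_walk_subset[OF w \<open>H \<subseteq> E\<close>] by simp
  moreover have "(\<Sum>x\<in>V. a - degree (V, flip_walk H p k) x) < (\<Sum>x\<in>V. a - degree (V, H) x)"
  proof (rule sum_strict_mono_ex1)
    show "finite V" using G by (simp add: finite_simple_graph_def)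
    show "\<forall>x\<in>V. a - degree (V, flip_walk H p k) x \<le> a - degree (V, H) x"
    proof
      fix x show "a - degree (V, flip_walk H p k) x \<le> a - degree (V, H) x"
        using ge[of x] by linarith
    qed
    have "degree (V, H) u < degree (V, flip_walk H p k) u"
      using deg[of u] aug u by (cases "u = p k") (auto simp: augmenting_def split: if_splits)
    then show "\<exists>x\<in>V. a - degree (V, flip_walk H p k) x < a - degree (V, H) x"
      using u by (intro bexI[of _ u]) auto
  qed
  ultimately show ?thesis by blast
qed

text \<open>Let \<open>D\<close> and \<open>A\<close> be the vertices reached by alternating walks
  of even and odd length. Without augmenting walks, \<open>H\<close>-degrees are at most
  \<open>a\<close> on \<open>D\<close> and at least \<open>b\<close> on \<open>A\<close>. Counting
  the edges of \<open>H\<close> between \<open>A\<close> and \<open>D\<close> from both sides gives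
  the inequality for \<open>S = A\<close>; it is strict because \<open>u\<close> is
  deficient.\<close>

lemma no_augmenting_obstruction:
  assumes G: "finite_simple_graph (V, E)" and "H \<subseteq> E" and "a < b"
    and u: "u \<in> V" "degree (V, H) u < a"
    and no: "\<And>p k. alternating_walk E H u p k \<Longrightarrow> \<not> augmenting a b (V, H) p k"
  shows "\<exists>S\<subseteq>V. b * card S < (\<Sum>x\<in>V - S. a - degree (delete_verts (V, E) S) x)"
proof -
  define D where "D = {p k |p k. alternating_walk E H u p k \<and> even k}"
  define A where "A = {p k |p k. alternating_walk E H u p k \<and> odd k}"
  have finV: "finite V" using G by (simp add: finite_simple_graph_def)
  have finE: "finite E" using finite_edges[OF G] by simp
  have finH: "finite H" using finE \<open>H \<subseteq> E\<close> finite_subset by auto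
  have uD: "u \<in> D"
    unfolding D_def by (rule CollectI, rule exI[of _ "\<lambda>_. u"], rule exI[of _ 0])
      (simp add: alternating_walk_def)
  have D: "degree (V, H) x \<le> a" if "x \<in> D" for x
    using that no unfolding D_def augmenting_def by fastforce
  have A: "b \<le> degree (V, H) x" if "x \<in> A" for x
    using that no unfolding A_def augmenting_def by fastforce
  have disj: "D \<inter> A = {}" using D A \<open>a < b\<close> by fastforce
  \<comment> \<open>Walks may repeat vertices, so any edge of the right kind extends them: one
    outside \<open>H\<close> leads from \<open>D\<close> to \<open>A\<close>, one in
    \<open>H\<close> from \<open>A\<close> to \<open>D\<close>.\<close>
  have DA: "y \<in> A" if x: "x \<in> D" and y: "{x, y} \<in> E - H" for x y
  proof -
    obtain p k where "alternating_walk E H u p k" "even k" "x = p k"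
      using x unfolding D_def by blast
    then have "alternating_walk E H u (p(Suc k := y)) (Suc k)"
      using y by (intro alternating_walk_snoc) auto
    then show ?thesis using \<open>even k\<close> unfolding A_def
      by (intro CollectI exI[of _ "p(Suc k := y)"] exI[of _ "Suc k"]) auto
  qed
  have AD: "y \<in> D" if x: "x \<in> A" and y: "{x, y} \<in> H" for x y
  proof -
    obtain p k where "alternating_walk E H u p k" "odd k" "x = p k"
      using x unfolding A_def by blast
    then have "alternating_walk E H u (p(Suc k := y)) (Suc k)"
      using y by (intro alternating_walk_snoc) auto
    then show ?thesis using \<open>odd k\<close> unfolding D_def
      by (intro CollectI exI[of _ "p(Suc k := y)"] exI[of _ "Suc k"]) auto
  qed
  have inV: "p k \<in> V" if "alternating_walk E H u p k" for p k
  proof (cases k)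
    case 0 then show ?thesis using that u by (simp add: alternating_walk_def)
  next
    case (Suc j)
    then have "{p j, p k} \<in> E"
      using alternating_walk_edge_in[OF that \<open>H \<subseteq> E\<close>, of j] by simp
    then show ?thesis using edge_ends_in_verts[OF G] by auto
  qed
  have sub: "D \<subseteq> V" "A \<subseteq> V" using inV by (auto simp: D_def A_def)
  then have finDA: "finite D" "finite A" using finV finite_subset by auto
  define F where "F = {e \<in> H. e \<inter> A \<noteq> {}}"
  have finF: "finite F" using finH by (simp add: F_def)
  have F: "card {x \<in> D. x \<in> e} = 1" "card {x \<in> A. x \<in> e} = 1" if e_F: "e \<in> F" for e
  proof -
    obtain x where x: "x \<in> A" "x \<in> e" "e \<in> H" using e_F by (auto simp: F_def)
    then obtain y where e: "e = {x, y}"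
      using edge_other_end[OF G, of e x] \<open>H \<subseteq> E\<close> by auto
    then have y: "y \<in> D" using AD x by auto
    then have "{x \<in> D. x \<in> e} = {y}" "{x \<in> A. x \<in> e} = {x}"
      using e x disj by auto
    then show "card {x \<in> D. x \<in> e} = 1" "card {x \<in> A. x \<in> e} = 1" by auto
  qed
  have "b * card A \<le> (\<Sum>x\<in>A. card {e \<in> F. x \<in> e})"
  proof -
    have "degree (V, H) x = card {e \<in> F. x \<in> e}" if "x \<in> A" for x
      unfolding degree_pair F_def using that by (intro arg_cong[of _ _ card]) auto
    then have "(\<Sum>x\<in>A. b) \<le> (\<Sum>x\<in>A. card {e \<in> F. x \<in> e})"
      using A by (intro sum_mono) auto
    then show ?thesis by (simp add: mult.commute)
  qed
  \<comment> \<open>Both sums equal \<open>card F\<close>, since each edge of \<open>F\<close> has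
    one end in \<open>A\<close> and one in \<open>D\<close>.\<close>
  also have "(\<Sum>x\<in>A. card {e \<in> F. x \<in> e}) = (\<Sum>x\<in>D. card {e \<in> F. x \<in> e})"
    using sum_multicount[of A F "\<lambda>x e. x \<in> e" 1] sum_multicount[of D F "\<lambda>x e. x \<in> e" 1]
      finDA finF F by simp
  also have "\<dots> < (\<Sum>x\<in>D. a - degree (delete_verts (V, E) A) x)"
  proof -
    \<comment> \<open>By \<open>DA\<close>, an edge at \<open>x\<close> that avoids \<open>A\<close>
      must belong to \<open>H\<close>. So the \<open>H\<close>-edges at \<open>x\<close> are all
      edges at \<open>x\<close> that survive deleting \<open>A\<close>, together with those in
      \<open>F\<close>.\<close>
    have split: "degree (V, H) x = degree (delete_verts (V, E) A) x + card {e \<in> F. x \<in> e}"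
      if "x \<in> D" for x
    proof -
      have "{e \<in> H. x \<in> e} = {e \<in> E. e \<inter> A = {} \<and> x \<in> e} \<union> {e \<in> F. x \<in> e}"
      proof -
        have "e \<in> H" if e: "e \<in> E" "e \<inter> A = {}" "x \<in> e" for e
        proof -
          obtain y where "e = {x, y}" using edge_other_end[OF G, of e x] e by auto
          then show ?thesis using e DA[OF \<open>x \<in> D\<close>, of y] by auto
        qed
        then show ?thesis using \<open>H \<subseteq> E\<close> by (auto simp: F_def)
      qed
      moreover have "card ({e \<in> E. e \<inter> A = {} \<and> x \<in> e} \<union> {e \<in> F. x \<in> e}) =
          card {e \<in> E. e \<inter> A = {} \<and> x \<in> e} + card {e \<in> F. x \<in> e}"
        using finE finH by (intro card_Un_disjoint) (auto simp: F_def)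
      ultimately show ?thesis by (simp add: degree_pair delete_verts_def conj_assoc)
    qed
    show ?thesis
    proof (rule sum_strict_mono_ex1[OF finDA(1)])
      have "card {e \<in> F. x \<in> e} \<le> a - degree (delete_verts (V, E) A) x" if "x \<in> D" for x
        using split[OF that] D[OF that] by simp
      then show "\<forall>x\<in>D. card {e \<in> F. x \<in> e} \<le> a - degree (delete_verts (V, E) A) x" by blast
      have "card {e \<in> F. u \<in> e} < a - degree (delete_verts (V, E) A) u"
        using split[OF uD] u by simp
      then show "\<exists>x\<in>D. card {e \<in> F. x \<in> e} < a - degree (delete_verts (V, E) A) x"
        using uD by blast
    qed
  qed
  also have "\<dots> \<le> (\<Sum>x\<in>V - A. a - degree (delete_verts (V, E) A) x)"
    using sub disj finV by (intro sum_mono2) auto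
  finally show ?thesis using sub by blast
qed

text \<open>The subtraction is truncated, so only the vertices of degree below a in G - S contribute.\<close>

lemma factor_criterion:
  assumes G: "finite_simple_graph G" and "a < b"
    and crit: "\<And>S. S \<subseteq> verts G \<Longrightarrow>
      (\<Sum>x\<in>verts G - S. a - degree (delete_verts G S) x) \<le> b * card S"
  shows "\<exists>H. is_factor a b H G"
proof -
  obtain V E where VE: "G = (V, E)" by (cases G)
  then have GVE: "finite_simple_graph (V, E)" using G by simp
  let ?P = "\<lambda>H. H \<subseteq> E \<and> (\<forall>x\<in>V. degree (V, H) x \<le> b)"
  have "?P {}" by (simp add: degree_pair)
  then obtain H where H: "?P H"
    and min: "\<And>H'. ?P H' \<Longrightarrow> (\<Sum>x\<in>V. a - degree (V, H) x) \<le> (\<Sum>x\<in>V. a - degree (V, H') x)"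
    using ex_has_least_nat[of ?P "{}" "\<lambda>H. \<Sum>x\<in>V. a - degree (V, H) x"] by blast
  have "a \<le> degree (V, H) u" if "u \<in> V" for u
  proof (rule ccontr)
    assume "\<not> a \<le> degree (V, H) u"
    then have u: "degree (V, H) u < a" by simp
    have "\<not> augmenting a b (V, H) p k" if w: "alternating_walk E H u p k" for p k
    proof
      assume "augmenting a b (V, H) p k"
      then obtain H' where "?P H'" "(\<Sum>x\<in>V. a - degree (V, H') x) < (\<Sum>x\<in>V. a - degree (V, H) x)"
        using augmenting_improves[OF GVE _ \<open>a < b\<close> \<open>u \<in> V\<close> u, of k] H w by blast
      then show False using min[of H'] by simp
    qed
    then obtain S where "S \<subseteq> V" "b * card S < (\<Sum>x\<in>V - S. a - degree (delete_verts (V, E) S) x)"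
      using no_augmenting_obstruction[OF GVE _ \<open>a < b\<close> \<open>u \<in> V\<close> u] H by blast
    then show False using crit[of S] VE by simp
  qed
  then have "is_factor a b (V, H) G"
    using H VE by (auto simp: is_factor_def spanning_subgraph_def)
  then show ?thesis by blast
qed

section \<open>Independent sets and isolated toughness\<close>

text \<open>Pick \<open>x\<close> of least degree in \<open>T\<close> and discard its closed
  neighbourhood. At most \<open>degree G x + 1\<close> vertices of \<open>T\<close> go, each with
  deficiency at most that of \<open>x\<close>, so their total is charged to \<open>x\<close>.
  Degrees are always taken in \<open>G\<close>, not in what remains.\<close>

lemma greedy_independent_set:
  assumes G: "finite_simple_graph G" and "T \<subseteq> verts G"
  shows "\<exists>I\<subseteq>T. (\<forall>x\<in>I. \<forall>y\<in>I. {x, y} \<notin> edges G) \<and>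
    (\<Sum>x\<in>T. a - degree G x) \<le> (\<Sum>x\<in>I. (a - degree G x) * (degree G x + 1))"
proof -
  have "finite T" using assms finite_subset by (auto simp: finite_simple_graph_def)
  then show ?thesis
  proof (induction T rule: finite_psubset_induct)
    case (psubset T)
    show ?case
    proof (cases "T = {}")
      case True then show ?thesis by auto
    next
      case False
      let ?d = "degree G"
      obtain x where x: "x \<in> T" "\<And>y. y \<in> T \<Longrightarrow> ?d x \<le> ?d y"
        using ex_min_if_finite[of "?d ` T"] psubset.hyps False
        by (metis arg_min_if_finite(1) arg_min_least)
      define N where "N = insert x {y. {x, y} \<in> edges G}"
      have finN: "finite N" using finite_nbrs[OF G] by (simp add: N_def)
      have cardN: "card N \<le> ?d x + 1"
        unfolding N_def degree_eq_card_nbrs[OF G] using finite_nbrs[OF G]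
        by (simp add: card_insert_if)
      have "T - N \<subset> T" using x by (auto simp: N_def)
      from psubset.IH[OF this] obtain I where I: "I \<subseteq> T - N" "\<forall>x\<in>I. \<forall>y\<in>I. {x, y} \<notin> edges G"
        "(\<Sum>x\<in>T - N. a - ?d x) \<le> (\<Sum>x\<in>I. (a - ?d x) * (?d x + 1))" by blast
      have "finite I" using I psubset.hyps by (meson finite_Diff finite_subset)
      have "x \<notin> I" using I by (auto simp: N_def)
      have "(\<Sum>y\<in>T \<inter> N. a - ?d y) \<le> (\<Sum>y\<in>T \<inter> N. a - ?d x)"
        using x by (intro sum_mono) (auto intro: diff_le_mono2)
      also have "\<dots> = card (T \<inter> N) * (a - ?d x)" by simp
      also have "\<dots> \<le> (?d x + 1) * (a - ?d x)"
        using card_mono[of N "T \<inter> N"] finN cardN by (intro mult_right_mono) auto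
      finally have 1: "(\<Sum>y\<in>T \<inter> N. a - ?d y) \<le> (a - ?d x) * (?d x + 1)"
        by (simp add: mult.commute)
      have "(\<Sum>y\<in>T. a - ?d y) = (\<Sum>y\<in>T \<inter> N. a - ?d y) + (\<Sum>y\<in>T - N. a - ?d y)"
        using psubset.hyps by (rule sum.Int_Diff)
      then have "(\<Sum>y\<in>T. a - ?d y) \<le> (\<Sum>y\<in>insert x I. (a - ?d y) * (?d y + 1))"
        using 1 I(3) \<open>finite I\<close> \<open>x \<notin> I\<close> by simp
      moreover have "\<forall>y\<in>insert x I. \<forall>z\<in>insert x I. {y, z} \<notin> edges G"
      proof -
        have "{x, y} \<notin> edges G" "{y, x} \<notin> edges G" if "y \<in> I" for y
          using I(1) that by (auto simp: N_def insert_commute)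
        moreover have "{x, x} \<notin> edges G" using edge_ends_distinct[OF G] by blast
        ultimately show ?thesis using I(2) by auto
      qed
      ultimately show ?thesis using x(1) I(1) by (intro exI[of _ "insert x I"]) auto
    qed
  qed
qed

lemma isolated_toughness_le:
  assumes G: "finite_simple_graph G" and "\<not> complete_graph G" and "S \<subseteq> verts G"
    and "2 \<le> num_isolated (delete_verts G S)"
  shows "isolated_toughness G * num_isolated (delete_verts G S) \<le> card S"
proof -
  let ?Q = "{real (card S) / real (num_isolated (delete_verts G S)) |S.
               S \<subseteq> verts G \<and> 2 \<le> num_isolated (delete_verts G S)}"
  have "?Q \<subseteq> (\<lambda>S. real (card S) / real (num_isolated (delete_verts G S))) ` Pow (verts G)" by auto
  then have "finite ?Q"
    using G by (meson finite_Pow_iff finite_imageI finite_simple_graph_def finite_subset)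
  then have "Min ?Q \<le> real (card S) / real (num_isolated (delete_verts G S))"
    using assms by (intro Min_le) auto
  then show ?thesis
    using assms by (simp add: isolated_toughness_def field_simps)
qed

text \<open>Deleting \<open>W\<close> and all neighbours of \<open>I\<close> outside
  \<open>W\<close> isolates every vertex of \<open>I\<close>. The number of those neighbours is at
  most the degree sum on the right.\<close>

lemma isolated_toughness_independent:
  assumes G: "finite_simple_graph G" and W: "W \<subseteq> verts G"
    and I: "I \<subseteq> verts G - W" "\<And>x y. x \<in> I \<Longrightarrow> y \<in> I \<Longrightarrow> {x, y} \<notin> edges G" "2 \<le> card I"
    and nonneg: "0 \<le> isolated_toughness G"
  shows "isolated_toughness G * card I \<le> card W + (\<Sum>x\<in>I. degree (delete_verts G W) x)"
proof -
  let ?K = "delete_verts G W"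
  have K: "finite_simple_graph ?K" using G by (rule finite_simple_graph_delete_verts)
  have finV: "finite (verts G)" using G by (simp add: finite_simple_graph_def)
  have "finite I" using I(3) by (intro card_ge_0_finite) simp
  define C where "C = (\<Union>x\<in>I. {y. {x, y} \<in> edges ?K})"
  have "card C \<le> (\<Sum>x\<in>I. degree ?K x)"
    unfolding C_def degree_eq_card_nbrs[OF K] using \<open>finite I\<close> by (rule card_UN_le)
  have "C \<subseteq> verts G" using edge_ends_in_verts[OF G] by (auto simp: C_def delete_verts_def)
  have "C \<inter> I = {}" using I(2) by (auto simp: C_def delete_verts_def)
  have "x \<in> verts (delete_verts G (W \<union> C)) \<and> degree (delete_verts G (W \<union> C)) x = 0" if "x \<in> I" for x
  proof -
    have "{y. {x, y} \<in> edges (delete_verts G (W \<union> C))} = {}"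
      using that by (auto simp: C_def delete_verts_def)
    then have "degree (delete_verts G (W \<union> C)) x = 0"
      by (simp add: degree_eq_card_nbrs[OF finite_simple_graph_delete_verts[OF G]])
    then show ?thesis using that I(1) \<open>C \<inter> I = {}\<close> by (auto simp: delete_verts_def)
  qed
  then have iso: "card I \<le> num_isolated (delete_verts G (W \<union> C))"
    unfolding num_isolated_def using finV by (intro card_mono) (auto simp: delete_verts_def)
  obtain x y where "x \<in> I" "y \<in> I" "x \<noteq> y"
    using I(3) \<open>finite I\<close> by (metis card_le_Suc0_iff_eq not_less_eq_eq numeral_2_eq_2)
  then have "\<not> complete_graph G" using I(1,2) unfolding complete_graph_def by blast
  then have "isolated_toughness G * num_isolated (delete_verts G (W \<union> C)) \<le> card (W \<union> C)"
    using iso I(3) W \<open>C \<subseteq> verts G\<close> by (intro isolated_toughness_le[OF G]) auto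
  \<comment> \<open>Vertices outside \<open>I\<close> may become isolated too; nonnegativity of the
    toughness allows for them.\<close>
  moreover have "isolated_toughness G * card I
      \<le> isolated_toughness G * num_isolated (delete_verts G (W \<union> C))"
    using iso nonneg by (intro mult_left_mono) auto
  moreover have "card (W \<union> C) \<le> card W + (\<Sum>x\<in>I. degree ?K x)"
    using card_Un_le[of W C] \<open>card C \<le> _\<close> by linarith
  ultimately show ?thesis by linarith
qed

text \<open>With \<open>c = a - 1 - d\<close> the two sides differ by \<open>c * (b - d)\<close>.
  This bounds the charge to a vertex plus \<open>b\<close> times its degree by the value at
  \<open>d = a - 1\<close>.\<close>

lemma weight_bound:
  fixes a b d :: nat
  assumes "d < a" "a < b"
  shows "(a - d) * (d + 1) + b * d \<le> a + b * (a - 1)"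
proof -
  obtain c where c: "a = d + 1 + c" using assms(1) by (auto dest: less_imp_Suc_add)
  have "c * d \<le> c * b" using assms by (intro mult_left_mono) auto
  then show ?thesis using c by (simp add: algebra_simps)
qed

section \<open>Combining the factor criterion with the toughness and degree bounds\<close>

theorem theorem4:
  fixes G :: "'a ugraph" and a b n :: nat
  assumes "1 \<le> a" and "a < b" and "1 \<le> n"
    and "finite_simple_graph G"
    and "min_degree G \<ge> a + n"
    and "isolated_toughness G \<ge> real a - 1 + real n + (real a - 1) / real b"
  shows "\<forall>V'. V' \<subseteq> verts G \<and> card V' = n \<longrightarrow> (\<exists>H. is_factor a b H (delete_verts G V'))"
proof (intro allI impI, elim conjE)
  fix V' assume V': "V' \<subseteq> verts G" "card V' = n"
  let ?G' = "delete_verts G V'"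
  note G = \<open>finite_simple_graph G\<close>
  have finV: "finite (verts G)" using G by (simp add: finite_simple_graph_def)
  show "\<exists>H. is_factor a b H ?G'"
  proof (rule factor_criterion[OF finite_simple_graph_delete_verts[OF G] \<open>a < b\<close>], rule ccontr)
    fix S assume S: "S \<subseteq> verts ?G'"
    define W where "W = V' \<union> S"
    define K where "K = delete_verts G W"
    assume "\<not> (\<Sum>x\<in>verts ?G' - S. a - degree (delete_verts ?G' S) x) \<le> b * card S"
    moreover have "verts ?G' - S = verts K" by (auto simp: delete_verts_def K_def W_def)
    ultimately have viol: "b * card S < (\<Sum>x\<in>verts K. a - degree K x)"
      by (simp add: delete_verts_delete_verts K_def W_def)
    have W: "W \<subseteq> verts G" "finite W" using S V' finV finite_subset
      by (auto simp: W_def delete_verts_def)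
    have cardW: "card W = n + card S"
      unfolding W_def V'(2)[symmetric] using W S
      by (intro card_Un_disjoint) (auto simp: W_def delete_verts_def)
    have K: "finite_simple_graph K" unfolding K_def using G by (rule finite_simple_graph_delete_verts)
    then have finK: "finite (verts K)" by (simp add: finite_simple_graph_def)
    define T where "T = {x \<in> verts K. degree K x < a}"
    have "(\<Sum>x\<in>verts K. a - degree K x) = (\<Sum>x\<in>T. a - degree K x)"
      using finK by (intro sum.mono_neutral_right) (auto simp: T_def)
    moreover obtain I where I: "I \<subseteq> T" "\<forall>x\<in>I. \<forall>y\<in>I. {x, y} \<notin> edges K"
      and "(\<Sum>x\<in>T. a - degree K x) \<le> (\<Sum>x\<in>I. (a - degree K x) * (degree K x + 1))"
      using greedy_independent_set[OF K, of T a] by (auto simp: T_def)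
    ultimately have less: "b * card S < (\<Sum>x\<in>I. (a - degree K x) * (degree K x + 1))"
      using viol by linarith
    have IV: "I \<subseteq> verts G - W" using I by (auto simp: T_def K_def delete_verts_def)
    then have "finite I" using finV finite_subset by auto
    consider "card I = 0" | "card I = 1" | "2 \<le> card I" by linarith
    then show False
    proof cases
      case 1
      then show False using less \<open>finite I\<close> by simp
    next
      case 2
      then obtain x where x: "I = {x}" by (rule card_1_singletonE)
      then have xV: "x \<in> verts G - W" "degree K x < a" using I IV by (auto simp: T_def)
      \<comment> \<open>The degree of \<open>x\<close> in \<open>G\<close> is at least
        \<open>a + n\<close>, and deleting \<open>W\<close> costs at most \<open>n + card S\<close>
        neighbours.\<close>
      then have "a - degree K x \<le> card S"
        using min_degree_le[OF G, of x] degree_le_degree_delete_verts[OF G W(2), of x] cardW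
          \<open>min_degree G \<ge> a + n\<close> by (simp add: K_def)
      \<comment> \<open>The second factor is at most \<open>a\<close>, hence at most
        \<open>b\<close>.\<close>
      then have "(a - degree K x) * (degree K x + 1) \<le> card S * b"
        using xV \<open>a < b\<close> by (intro mult_mono) auto
      then show False using less x by (simp add: mult.commute)
    next
      case 3
      let ?m = "card I" and ?t = "\<Sum>x\<in>I. degree K x"
      have indep: "{x, y} \<notin> edges G" if "x \<in> I" "y \<in> I" for x y
        using I(2) that IV by (auto simp: K_def delete_verts_def)
      define t where "t = real a - 1 + real n + (real a - 1) / real b"
      have "0 \<le> t" using \<open>1 \<le> a\<close> by (simp add: t_def)
      then have "isolated_toughness G * ?m \<le> card W + ?t"
        using isolated_toughness_independent[OF G W(1) IV indep 3] assms(6)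
        by (simp add: K_def t_def)
      moreover have "t * ?m \<le> isolated_toughness G * ?m"
        using assms(6) by (intro mult_right_mono) (auto simp: t_def)
      ultimately have "t * ?m \<le> n + card S + ?t" using cardW by simp
      then have "b * (t * ?m) \<le> b * real (n + card S + ?t)" by (intro mult_left_mono) auto
      then have "(b * t) * ?m \<le> b * real (n + card S + ?t)" by (simp only: mult.assoc)
      moreover have "b * t = b * (real a - 1) + b * real n + (real a - 1)"
      proof -
        have "real b \<noteq> 0" using \<open>a < b\<close> by simp
        then show ?thesis by (simp add: t_def distrib_left right_diff_distrib
              add_divide_distrib diff_divide_distrib)
      qed
      ultimately have tough: "(b * (real a - 1) + b * real n + (real a - 1)) * ?m
          \<le> b * n + b * card S + b * ?t"
        by (simp add: distrib_left)
      have "(\<Sum>x\<in>I. (a - degree K x) * (degree K x + 1) + b * degree K x)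
          \<le> (\<Sum>x\<in>I. a + b * (a - 1))"
        using I(1) \<open>a < b\<close> by (intro sum_mono weight_bound) (auto simp: T_def)
      \<comment> \<open>The strict inequality between natural numbers supplies the summand 1, which
        the final comparison needs.\<close>
      then have "b * card S + 1 + b * ?t \<le> ?m * (a + b * (a - 1))"
        using less by (simp add: sum.distrib sum_distrib_left)
      then have "real (b * card S + 1 + b * ?t) \<le> real (?m * (a + b * (a - 1)))"
        by (simp only: of_nat_le_iff)
      then have "b * real (card S) + 1 + b * real ?t \<le> ?m * (a + b * (real a - 1))"
        using \<open>1 \<le> a\<close> by (simp add: of_nat_diff)
      \<comment> \<open>Adding the two estimates cancels \<open>card S\<close>, \<open>?t\<close>
        and the terms \<open>b * (a - 1)\<close>; the fraction \<open>(a - 1) / b\<close> in the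
        toughness bound leaves exactly \<open>-1\<close> beside \<open>b * n\<close>. As
        \<open>b * n\<close> is at least 2, this forces \<open>?m \<le> 1\<close>.\<close>
      with tough have "(real b * n - 1) * ?m \<le> real b * n - 1"
        by (simp add: algebra_simps)
      moreover have "2 * 1 \<le> b * n" using assms(1-3) by (intro mult_le_mono) auto
      then have "1 < real b * n" by (simp flip: of_nat_mult)
      ultimately have "real ?m \<le> 1" by (simp add: mult_le_cancel_left1)
      then show False using 3 by simp
    qed
  qed
qed

end
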